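(* Let $X$ and $Y$ be non-degenerate compact metrizable spaces, and suppose that $T : \operatorname{SPM}(X) \to \operatorname{SPM}(Y)$ is a surjective isometry, or that $T : \operatorname{SPM}(X) \cap \operatorname{AM}(X) \to \operatorname{SPM}(Y) \cap \operatorname{AM}(Y)$ is a surjective isometry. Then there exists a unique extension $\overline{T} : \operatorname{PM}(X) \to \operatorname{PM}(Y)$ of $T$ which is a real-linear surjective isometry.
   Context: A space is non-degenerate if it contains at least two points. For a topological space $Z$, $\operatorname{C}(Z^2)$ denotes the Banach space of bounded continuous real-valued functions on $Z^2 = Z \times Z$ with the sup-norm $\|\cdot\|$. $\operatorname{PM}(Z) \subset \operatorname{C}(Z^2)$ is the subspace of bounded continuous pseudometrics on $Z$; $\operatorname{AM}(Z) \subset \operatorname{PM}(Z)$ is the subspace of admissible metrics, that is, metrics (in $\operatorname{PM}(Z)$) that induce the original topology of $Z$; and $\operatorname{SPM}(Z) = \{d \in \operatorname{PM}(Z) \mid \|d\| = 1\}$ is the unit sphere of $\operatorname{PM}(Z)$. All these sets carry the sup-metric $(d,\rho) \mapsto \|d - \rho\|$, and isometries are with respect to these metrics. A map $\overline{T} : \operatorname{PM}(X) \to \operatorname{PM}(Y)$ is called real-linear if $\overline{T}(\alpha d + \beta \rho) = \alpha \overline{T}(d) + \beta \overline{T}(\rho)$ for all $d, \rho \in \operatorname{PM}(X)$ and all real numbers $\alpha, \beta \geq 0$. *)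

theory Defs
  imports "HOL-Analysis.Analysis"
begin

definition PM :: "(('a::topological_space \<times> 'a) \<Rightarrow>\<^sub>C real) set" where
  "PM = {d :: ('a \<times> 'a) \<Rightarrow>\<^sub>C real.
            (\<forall>x y. 0 \<le> d (x, y)) \<and> (\<forall>x. d (x, x) = 0) \<and>
            (\<forall>x y. d (x, y) = d (y, x)) \<and>
            (\<forall>x y z. d (x, z) \<le> d (x, y) + d (y, z))}"

definition AM :: "(('a::topological_space \<times> 'a) \<Rightarrow>\<^sub>C real) set" where
  "AM = {d \<in> PM. Metric_space UNIV (\<lambda>x y. d (x, y)) \<and>
                 Metric_space.mtopology UNIV (\<lambda>x y. d (x, y)) = euclidean}"

definition SPM :: "(('a::topological_space \<times> 'a) \<Rightarrow>\<^sub>C real) set" where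
  "SPM = {d \<in> PM. norm d = 1}"

text \<open>Only the values of the map on \<open>A\<close> matter, and surjective means onto \<open>B\<close>.\<close>
definition surjective_isometry ::
  "'b::metric_space set \<Rightarrow> 'c::metric_space set \<Rightarrow> ('b \<Rightarrow> 'c) \<Rightarrow> bool" where
  "surjective_isometry A B T \<longleftrightarrow>
     T ` A = B \<and> (\<forall>d\<in>A. \<forall>\<rho>\<in>A. dist (T d) (T \<rho>) = dist d \<rho>)"

text \<open>Linearity on the convex cone of pseudometrics: only non-negative coefficients occur.\<close>
definition real_linear ::
  "((('a::topological_space \<times> 'a) \<Rightarrow>\<^sub>C real) \<Rightarrow> (('b::topological_space \<times> 'b) \<Rightarrow>\<^sub>C real)) \<Rightarrow> bool" where
  "real_linear T \<longleftrightarrow>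
     (\<forall>d\<in>PM. \<forall>\<rho>\<in>PM. \<forall>\<alpha>\<ge>0. \<forall>\<beta>\<ge>0.
        T (\<alpha> *\<^sub>R d + \<beta> *\<^sub>R \<rho>) = \<alpha> *\<^sub>R T d + \<beta> *\<^sub>R T \<rho>)"

end

(* The relation "dist d rho = 1" on the unit sphere says that one of the two pseudometrics vanishes at a
   pair where the other one equals 1. Among the sets far d = {rho. dist d rho = 1}, the minimal ones are
   exactly the sets {rho. rho p = 0} for pairs p of distinct points, so an isometry T permutes these; it
   therefore also permutes the faces {rho. rho p = 1}, which consist of the points far from all of
   {rho. rho p = 0}. The distance from d to such a face is 1 - d p, hence T d q = d p for corresponding
   pairs p and q, and the homogeneous extension of T inherits this formula. Admissible metrics are dense
   in the sphere, which reduces the second case to the first by completion. *)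
theory Submission
  imports Defs
begin

section \<open>Surjective isometries and their extension to closures\<close>

text \<open>A Cauchy sequence for the sup-metric is uniformly Cauchy, and a uniform limit of bounded
  continuous functions is bounded and continuous; the domain may be any topological space.\<close>

lemma bcontfun_complete:
  "complete (UNIV :: ('a::topological_space \<Rightarrow>\<^sub>C 'b::complete_space) set)"
  unfolding complete_def
proof safe
  fix f :: "nat \<Rightarrow> 'a \<Rightarrow>\<^sub>C 'b"
  assume "Cauchy f"
  then have "\<forall>e>0. \<exists>N. \<forall>m\<ge>N. \<forall>n\<ge>N. \<forall>x. dist (f m x) (f n x) < e"
    unfolding Cauchy_def by (meson dist_fun_lt_imp_dist_val_lt)
  then have "\<forall>e>0. \<exists>N. \<forall>m n x. N \<le> m \<and> N \<le> n \<and> True \<longrightarrow> dist (f m x) (f n x) < e"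
    by blast
  then obtain g where "uniform_limit UNIV f g sequentially"
    using uniformly_convergent_eq_cauchy[of "\<lambda>_. True" "\<lambda>n. apply_bcontfun (f n)"]
    by (auto simp: uniform_limit_sequentially_iff)
  then show "\<exists>l\<in>UNIV. f \<longlonglongrightarrow> l"
    by (metis UNIV_I sequentially_bot uniform_limit_bcontfunE)
qed

lemma surjective_isometryD:
  assumes "surjective_isometry A B T"
  shows "a \<in> A \<Longrightarrow> T a \<in> B" "b \<in> B \<Longrightarrow> \<exists>a\<in>A. T a = b"
    "a \<in> A \<Longrightarrow> a' \<in> A \<Longrightarrow> dist (T a) (T a') = dist a a'"
  using assms unfolding surjective_isometry_def by auto

lemma surjective_isometry_inv_into:
  assumes "surjective_isometry A B T"
  shows "inj_on T A" "surjective_isometry B A (inv_into A T)"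
proof -
  show inj: "inj_on T A"
    using surjective_isometryD(3)[OF assms] by (metis dist_eq_0_iff inj_onI)
  have im: "T ` A = B" using assms unfolding surjective_isometry_def by blast
  show "surjective_isometry B A (inv_into A T)"
    unfolding surjective_isometry_def
  proof (intro conjI ballI)
    show "inv_into A T ` B = A" using im inj by (metis inv_into_image_cancel subset_refl)
    fix b b' assume "b \<in> B" "b' \<in> B"
    then show "dist (inv_into A T b) (inv_into A T b') = dist b b'"
      using surjective_isometryD(3)[OF assms] im
      by (metis f_inv_into_f inv_into_into)
  qed
qed

text \<open>An isometry sends Cauchy sequences to Cauchy sequences. Completeness of the target
  defines the extension by limits; completeness of the source keeps it surjective.\<close>

lemma surjective_isometry_closure:
  fixes T :: "'b::metric_space \<Rightarrow> 'c::metric_space"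
  assumes T: "surjective_isometry A B T"
    and cb: "complete (UNIV :: 'b set)" and cc: "complete (UNIV :: 'c set)"
  obtains U where "surjective_isometry (closure A) (closure B) U" "\<And>a. a \<in> A \<Longrightarrow> U a = T a"
proof -
  note TD = surjective_isometryD[OF T]
  have "\<forall>x\<in>closure A. \<exists>s. (\<forall>n. s n \<in> A) \<and> s \<longlonglongrightarrow> x"
    by (simp add: closure_sequential)
  then obtain s where sA: "\<And>x n. x \<in> closure A \<Longrightarrow> s x n \<in> A"
    and sl: "\<And>x. x \<in> closure A \<Longrightarrow> s x \<longlonglongrightarrow> x" by metis
  have "\<exists>l. (\<lambda>n. T (s x n)) \<longlonglongrightarrow> l" if x: "x \<in> closure A" for x
  proof -
    have "Cauchy (s x)" using sl[OF x] by (simp add: LIMSEQ_imp_Cauchy)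
    then have "Cauchy (\<lambda>n. T (s x n))"
      unfolding Cauchy_def by (simp add: TD(3) sA x)
    then show ?thesis using cc by (auto simp: complete_def)
  qed
  then obtain U where U: "\<And>x. x \<in> closure A \<Longrightarrow> (\<lambda>n. T (s x n)) \<longlonglongrightarrow> U x" by metis
  have iso: "dist (U x) (U y) = dist x y" if xy: "x \<in> closure A" "y \<in> closure A" for x y
  proof -
    have "(\<lambda>n. dist (T (s x n)) (T (s y n))) \<longlonglongrightarrow> dist (U x) (U y)"
      using U xy by (intro tendsto_dist) auto
    moreover have "(\<lambda>n. dist (s x n) (s y n)) \<longlonglongrightarrow> dist x y"
      using sl xy by (intro tendsto_dist) auto
    ultimately show ?thesis using LIMSEQ_unique by (simp add: TD(3) sA xy)
  qed
  have ext: "U a = T a" if a: "a \<in> A" for a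
  proof -
    have a': "a \<in> closure A" using a closure_subset by blast
    have "(\<lambda>n. dist (s a n) a) \<longlonglongrightarrow> 0" using sl[OF a'] tendsto_dist_iff[THEN iffD1] by blast
    then have "(\<lambda>n. dist (T (s a n)) (T a)) \<longlonglongrightarrow> 0" by (simp add: TD(3) sA a a')
    then have "(\<lambda>n. T (s a n)) \<longlonglongrightarrow> T a" by (rule tendsto_dist_iff[THEN iffD2])
    then show ?thesis using U[OF a'] LIMSEQ_unique by blast
  qed
  have sub: "U x \<in> closure B" if x: "x \<in> closure A" for x
    unfolding closure_sequential
    by (rule exI[of _ "\<lambda>n. T (s x n)"]) (use U[OF x] sA[OF x] TD(1) in auto)
  have "y \<in> U ` closure A" if y: "y \<in> closure B" for y
  proof -
    obtain b where b: "\<And>n. b n \<in> B" "b \<longlonglongrightarrow> y" using y by (auto simp: closure_sequential)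
    have "\<forall>n. \<exists>a. a \<in> A \<and> T a = b n" using TD(2) b(1) by blast
    then have "\<exists>a. \<forall>n. a n \<in> A \<and> T (a n) = b n" by (rule choice)
    then obtain a where a: "\<And>n. a n \<in> A" "\<And>n. T (a n) = b n" by blast
    have "Cauchy b" using b(2) by (simp add: LIMSEQ_imp_Cauchy)
    \<comment> \<open>Distances between the chosen preimages equal those between the points
      \<open>b n\<close>, so the preimages converge as well.\<close>
    then have "Cauchy a" unfolding Cauchy_def by (simp add: a TD(3)[symmetric])
    then obtain x where x: "a \<longlonglongrightarrow> x" using cb by (auto simp: complete_def)
    then have xA: "x \<in> closure A" using a(1) by (auto simp: closure_sequential)
    have aA: "a n \<in> closure A" for n using a(1) closure_subset by blast
    have "(\<lambda>n. dist (a n) x) \<longlonglongrightarrow> 0" using x by (rule tendsto_dist_iff[THEN iffD1])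
    moreover have "dist (a n) x = dist (b n) (U x)" for n
      using iso[OF aA xA] ext[OF a(1)] a(2) by metis
    ultimately have "b \<longlonglongrightarrow> U x" using tendsto_dist_iff[of b "U x"] by simp
    then show ?thesis using b(2) xA LIMSEQ_unique by blast
  qed
  then have "surjective_isometry (closure A) (closure B) U"
    unfolding surjective_isometry_def using sub iso by auto
  then show thesis using that ext by blast
qed

section \<open>The cone of pseudometrics, its unit sphere and admissible metrics\<close>

lemma PM_D:
  assumes "d \<in> PM"
  shows "0 \<le> d (x, y)" "d (x, x) = 0" "d (x, y) = d (y, x)" "d (x, z) \<le> d (x, y) + d (y, z)"
  using assms unfolding PM_def by blast+

lemma PM_zero: "0 \<in> PM"
  by (simp add: PM_def)

lemma PM_comb:
  assumes "d \<in> PM" "\<rho> \<in> PM" "0 \<le> \<alpha>" "0 \<le> \<beta>"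
  shows "\<alpha> *\<^sub>R d + \<beta> *\<^sub>R \<rho> \<in> PM"
  unfolding PM_def
proof (intro CollectI conjI allI)
  fix x y z
  have "\<alpha> * d (x, z) \<le> \<alpha> * (d (x, y) + d (y, z))" "\<beta> * \<rho> (x, z) \<le> \<beta> * (\<rho> (x, y) + \<rho> (y, z))"
    using assms by (intro mult_left_mono PM_D(4); simp)+
  then show "(\<alpha> *\<^sub>R d + \<beta> *\<^sub>R \<rho>) (x, z) \<le> (\<alpha> *\<^sub>R d + \<beta> *\<^sub>R \<rho>) (x, y) + (\<alpha> *\<^sub>R d + \<beta> *\<^sub>R \<rho>) (y, z)"
    by (simp add: algebra_simps)
qed (use assms in \<open>auto simp: PM_D intro: PM_D(3)\<close>)

lemma PM_scale: "d \<in> PM \<Longrightarrow> 0 \<le> \<alpha> \<Longrightarrow> \<alpha> *\<^sub>R d \<in> PM"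
  using PM_comb[of d d \<alpha> 0] by simp

lemma SPM_D:
  assumes "d \<in> SPM"
  shows "d \<in> PM" "norm d = 1" "d p \<le> 1"
proof -
  show "d \<in> PM" "norm d = 1" using assms by (auto simp: SPM_def)
  then show "d p \<le> 1" using norm_bounded[of d p] by simp
qed

lemma SPM_normalize: "d \<in> PM \<Longrightarrow> d \<noteq> 0 \<Longrightarrow> (1 / norm d) *\<^sub>R d \<in> SPM"
  by (simp add: SPM_def PM_scale)

lemma SPM_dist_le_1:
  fixes d \<rho> :: "('a::topological_space \<times> 'a) \<Rightarrow>\<^sub>C real"
  assumes "d \<in> SPM" "\<rho> \<in> SPM"
  shows "dist d \<rho> \<le> 1"
proof (rule dist_bound)
  fix p :: "'a \<times> 'a"
  obtain a b where p: "p = (a, b)" by (metis surj_pair)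
  have "0 \<le> d p" "d p \<le> 1" "0 \<le> \<rho> p" "\<rho> p \<le> 1"
    using assms SPM_D PM_D(1) unfolding p by blast+
  then show "dist (d p) (\<rho> p) \<le> 1" by (simp add: dist_real_def)
qed

text \<open>Convergence in the sup-norm implies pointwise convergence, and the pseudometric axioms
  are equalities and weak inequalities between values at points.\<close>

lemma closed_PM: "closed (PM :: (('a::topological_space \<times> 'a) \<Rightarrow>\<^sub>C real) set)"
  unfolding closed_sequential_limits
proof safe
  fix f :: "nat \<Rightarrow> ('a \<times> 'a) \<Rightarrow>\<^sub>C real" and l
  assume f: "\<forall>n. f n \<in> PM" and l: "f \<longlonglongrightarrow> l"
  have lim: "(\<lambda>n. f n p) \<longlonglongrightarrow> l p" for p
    using tendsto_bcontfun_uniform_limit[OF l] by (rule tendsto_uniform_limitI) simp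
  show "l \<in> PM"
    unfolding PM_def
  proof (intro CollectI conjI allI)
    fix x y z
    show "0 \<le> l (x, y)" using LIMSEQ_le_const[OF lim] f PM_D(1) by blast
    have "f n (x, x) = 0" for n using f PM_D(2) by blast
    then show "l (x, x) = 0" using lim[of "(x, x)"] by (simp add: LIMSEQ_const_iff)
    have "f n (x, y) = f n (y, x)" for n using f PM_D(3) by blast
    then show "l (x, y) = l (y, x)"
      using lim[of "(x, y)"] lim[of "(y, x)"] LIMSEQ_unique by simp
    show "l (x, z) \<le> l (x, y) + l (y, z)"
      using LIMSEQ_le[OF lim tendsto_add[OF lim lim]] f PM_D(4) by blast
  qed
qed

lemma closed_SPM: "closed (SPM :: (('a::topological_space \<times> 'a) \<Rightarrow>\<^sub>C real) set)"
proof -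
  have "closed {d :: ('a \<times> 'a) \<Rightarrow>\<^sub>C real. norm d = 1}"
    by (intro closed_Collect_eq continuous_intros)
  moreover have "SPM = PM \<inter> {d :: ('a \<times> 'a) \<Rightarrow>\<^sub>C real. norm d = 1}" by (auto simp: SPM_def)
  ultimately show ?thesis using closed_Int[OF closed_PM] by metis
qed

text \<open>Balls of \<open>e\<close> are open because \<open>e\<close> is continuous. Conversely,
  the \<open>e\<close>-ball of radius \<open>c * r\<close> lies inside the
  \<open>\<delta>\<close>-ball of radius \<open>r\<close>, so both topologies agree; the same
  inequality makes \<open>e\<close> separate points.\<close>

lemma AM_ge:
  assumes \<delta>: "\<delta> \<in> AM" and e: "e \<in> PM" and c: "0 < c" and le: "\<And>p. c * \<delta> p \<le> e p"
  shows "e \<in> AM"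
proof -
  interpret D: Metric_space UNIV "\<lambda>x y. \<delta> (x, y)" using \<delta> by (simp add: AM_def)
  have top: "D.mtopology = euclidean" using \<delta> by (simp add: AM_def)
  have pos: "x = y" if "e (x, y) = 0" for x y
    using le[of "(x, y)"] c D.nonneg[of x y] D.zero[of x y] that
    by (metis UNIV_I mult_le_0_iff not_less order_antisym)
  interpret E: Metric_space UNIV "\<lambda>x y. e (x, y)"
  proof
    show "0 \<le> e (x, y)" "e (x, y) = e (y, x)" for x y using e PM_D by blast+
    show "(e (x, y) = 0) = (x = y)" for x y using pos PM_D(2)[OF e] by blast
    show "e (x, z) \<le> e (x, y) + e (y, z)" for x y z using PM_D(4)[OF e] .
  qed
  have "openin E.mtopology U \<longleftrightarrow> open U" for U
  proof
    assume U: "openin E.mtopology U"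
    show "open U"
    proof (subst open_subopen, safe)
      fix x assume "x \<in> U"
      then obtain r where r: "r > 0" "E.mball x r \<subseteq> U" using U E.openin_mtopology by blast
      have "open {y. e (x, y) < r}"
        by (intro open_Collect_less continuous_intros continuous_on_compose2[OF continuous_on_apply_bcontfun[of UNIV e]]) auto
      moreover have "x \<in> {y. e (x, y) < r}" "{y. e (x, y) < r} \<subseteq> U"
        using r PM_D(2)[OF e] by (auto simp: subset_iff)
      ultimately show "\<exists>T. open T \<and> x \<in> T \<and> T \<subseteq> U" by blast
    qed
  next
    assume "open U"
    then have U: "openin D.mtopology U" using top by simp
    show "openin E.mtopology U"
      unfolding E.openin_mtopology
    proof (intro conjI allI impI)
      fix x assume "x \<in> U"
      then obtain r where r: "r > 0" "D.mball x r \<subseteq> U" using U D.openin_mtopology by blast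
      have "\<delta> (x, y) < r" if "e (x, y) < c * r" for y
        using mult_less_cancel_left_pos[OF c] le_less_trans[OF le that] by blast
      then have "E.mball x (c * r) \<subseteq> U" using r by (auto simp: subset_iff)
      then show "\<exists>r>0. E.mball x r \<subseteq> U" using mult_pos_pos[OF c r(1)] by blast
    qed simp
  qed
  then have "E.mtopology = euclidean" by (simp add: topology_eq)
  then show ?thesis using e E.Metric_space_axioms by (simp add: AM_def)
qed

section \<open>Constructing pseudometrics on a compact metrizable space\<close>

text \<open>The metrizing metric is fixed as a bounded continuous function, so that it lies in the
  cone itself and can be combined with other pseudometrics.\<close>

locale compact_metrized =
  fixes \<delta> :: "('a::topological_space \<times> 'a) \<Rightarrow>\<^sub>C real"
  assumes compact_UNIV: "compact (UNIV :: 'a set)"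
    and AM: "\<delta> \<in> AM"
    and nondegenerate: "\<exists>x y :: 'a. x \<noteq> y"
begin

lemma compact_UNIV_prod: "compact (UNIV :: ('a \<times> 'a) set)"
  using compact_Times[OF compact_UNIV compact_UNIV] by simp

lemma PM: "\<delta> \<in> PM"
  using AM by (simp add: AM_def)

lemma eq_0_iff: "\<delta> (x, y) = 0 \<longleftrightarrow> x = y"
proof -
  interpret Metric_space UNIV "\<lambda>x y. \<delta> (x, y)" using AM by (simp add: AM_def)
  show ?thesis using zero by simp
qed

text \<open>Compactness makes the function bounded. Through this lemma, pseudometrics given by
  explicit formulas become elements of \<open>PM\<close>.\<close>

lemma PM_of_continuous:
  fixes f :: "'a \<times> 'a \<Rightarrow> real"
  assumes cont: "continuous_on UNIV f" and "\<And>x y. 0 \<le> f (x, y)" "\<And>x. f (x, x) = 0"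
    "\<And>x y. f (x, y) = f (y, x)" "\<And>x y z. f (x, z) \<le> f (x, y) + f (y, z)"
  obtains d where "d \<in> PM" "\<And>p. apply_bcontfun d p = f p"
proof -
  have "f \<in> bcontfun"
    using cont compact_continuous_image[OF cont compact_UNIV_prod]
    by (simp add: bcontfun_def compact_imp_bounded)
  then have eq: "apply_bcontfun (Bcontfun f) = f" by (rule Bcontfun_inverse)
  have "Bcontfun f \<in> PM"
    unfolding PM_def mem_Collect_eq eq using assms(2-5) by blast
  then show thesis using that eq by simp
qed

lemma continuous_on_slice:
  fixes d :: "('a \<times> 'a) \<Rightarrow>\<^sub>C real"
  assumes "continuous_on S f"
  shows "continuous_on S (\<lambda>p. d (f p, c))"
proof (rule continuous_on_compose2[OF continuous_on_apply_bcontfun[of UNIV d]])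
  show "continuous_on S (\<lambda>p. (f p, c))" by (intro continuous_intros assms)
qed simp

text \<open>Compactness turns a statement about the sup-distance into one about the values at a
  single pair.\<close>

lemma dist_attained:
  fixes d \<rho> :: "('a \<times> 'a) \<Rightarrow>\<^sub>C real"
  obtains p where "dist d \<rho> = \<bar>d p - \<rho> p\<bar>"
proof -
  have "continuous_on UNIV (\<lambda>p. \<bar>d p - \<rho> p\<bar>)" by (intro continuous_intros) auto
  then obtain p where p: "\<And>q. \<bar>d q - \<rho> q\<bar> \<le> \<bar>d p - \<rho> p\<bar>"
    using continuous_attains_sup[OF compact_UNIV_prod] by fastforce
  have "dist d \<rho> \<le> \<bar>d p - \<rho> p\<bar>" using p by (intro dist_bound) (simp add: dist_real_def)
  moreover have "\<bar>d p - \<rho> p\<bar> \<le> dist d \<rho>" using dist_bounded[of d p \<rho>] by (simp add: dist_real_def)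
  ultimately show thesis using that[OF antisym] by blast
qed

lemma norm_attained:
  assumes "d \<in> PM"
  obtains x y :: 'a where "norm d = d (x, y)"
proof -
  obtain p where "dist d 0 = \<bar>d p - 0\<bar>" using dist_attained[of d 0] by auto
  then show thesis using that PM_D(1)[OF assms] by (cases p) (auto simp: dist_norm)
qed

lemma SPM_attained:
  assumes "d \<in> SPM"
  obtains x y :: 'a where "d (x, y) = 1" "x \<noteq> y"
proof -
  obtain x y :: 'a where "norm d = d (x, y)" using norm_attained SPM_D(1)[OF assms] by blast
  then have "d (x, y) = 1" using SPM_D(2)[OF assms] by simp
  moreover have "x \<noteq> y" using calculation PM_D(2)[OF SPM_D(1)[OF assms], of x] by auto
  ultimately show thesis by (rule that)
qed

text \<open>Normalised, the function \<open>a \<mapsto> \<sigma>(a,u) / (\<sigma>(a,u) + \<sigma>(a,v))\<close> separates the classes of \<open>u\<close> and \<open>v\<close>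
  sharply enough for the maximal distance to be attained nowhere else.\<close>
lemma peak:
  fixes u v :: 'a
  assumes \<sigma>: "\<sigma> \<in> PM" and uv: "\<sigma> (u, v) \<noteq> 0"
  obtains \<rho> where "\<rho> \<in> SPM" "\<And>a b. \<rho> (a, b) = 0 \<longleftrightarrow> \<sigma> (a, b) = 0" "\<rho> (u, v) = 1"
    "\<And>a b. \<rho> (a, b) = 1 \<Longrightarrow> \<sigma> (a, u) = 0 \<and> \<sigma> (b, v) = 0 \<or> \<sigma> (a, v) = 0 \<and> \<sigma> (b, u) = 0"
proof -
  note P = PM_D[OF \<sigma>]
  have uv: "0 < \<sigma> (u, v)" using uv P(1)[of u v] by simp
  define h where "h a = \<sigma> (a, u) / (\<sigma> (a, u) + \<sigma> (a, v))" for a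
  have den: "0 < \<sigma> (a, u) + \<sigma> (a, v)" for a using P(4)[of u v a] P(3)[of u a] uv by linarith
  have h01: "0 \<le> h a" "h a \<le> 1" for a using den[of a] P(1) by (simp_all add: h_def)
  have h0: "h a = 0 \<longleftrightarrow> \<sigma> (a, u) = 0" for a using den[of a] by (simp add: h_def)
  have h1: "h a = 1 \<longleftrightarrow> \<sigma> (a, v) = 0" for a using den[of a] by (simp add: h_def)
  \<comment> \<open>\<open>h\<close> is constant on the classes of \<open>\<sigma>\<close>, so it
    adds no new non-zero values where \<open>\<sigma>\<close> vanishes.\<close>
  have hc: "h a = h b" if "\<sigma> (a, b) = 0" for a b
  proof -
    have "\<sigma> (a, c) = \<sigma> (b, c)" for c using P(4)[of a c b] P(4)[of b c a] P(3)[of a b] that by linarith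
    then show ?thesis by (simp add: h_def)
  qed
  have N: "0 < norm \<sigma>" using uv norm_bounded[of \<sigma> "(u, v)"] by (simp del: zero_less_norm_iff)
  \<comment> \<open>With this factor the second term of the maximum is at most 1/2: the value 1 can
    come only from \<open>h\<close>, while the zero set stays that of
    \<open>\<sigma>\<close>.\<close>
  define c where "c = 1 / (2 * norm \<sigma>)"
  have c: "0 < c" using N by (simp add: c_def)
  have half: "c * \<sigma> p \<le> 1 / 2" for p
    using norm_bounded[of \<sigma> p] N by (simp add: c_def field_simps)
  let ?f = "\<lambda>p. max \<bar>h (fst p) - h (snd p)\<bar> (c * \<sigma> p)"
  obtain \<rho> where \<rho>: "\<rho> \<in> PM" "\<And>p. apply_bcontfun \<rho> p = ?f p"
  proof (rule PM_of_continuous[of ?f])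
    show "continuous_on UNIV ?f"
      unfolding h_def using den
      by (intro continuous_intros continuous_on_slice continuous_on_apply_bcontfun ballI less_imp_neq[symmetric])
    show "0 \<le> ?f (x, y)" "?f (x, x) = 0" "?f (x, y) = ?f (y, x)" for x y
      using P c by (auto simp: abs_minus_commute)
    show "?f (x, z) \<le> ?f (x, y) + ?f (y, z)" for x y z
    proof -
      have "c * \<sigma> (x, z) \<le> c * \<sigma> (x, y) + c * \<sigma> (y, z)"
        using P(4)[of x z y] c by (metis distrib_left mult_left_mono order_less_imp_le)
      then show ?thesis by auto
    qed
  qed blast
  have le1: "\<rho> p \<le> 1" for p
    using h01[of "fst p"] h01[of "snd p"] half[of p] unfolding \<rho>(2) by (auto simp: abs_le_iff)
  have huv: "h u = 0" "h v = 1" using h0 h1 P(2) by auto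
  have one: "\<rho> (u, v) = 1" using half[of "(u, v)"] unfolding \<rho>(2) huv fst_conv snd_conv by linarith
  have "norm \<rho> = 1"
  proof (rule antisym)
    show "norm \<rho> \<le> 1"
      using le1 PM_D(1)[OF \<rho>(1)] by (intro norm_bound) (metis abs_of_nonneg real_norm_def surj_pair)
    show "1 \<le> norm \<rho>" using norm_bounded[of \<rho> "(u, v)"] one by simp
  qed
  then have "\<rho> \<in> SPM" using \<rho>(1) by (simp add: SPM_def)
  moreover have "\<rho> (a, b) = 0 \<longleftrightarrow> \<sigma> (a, b) = 0" for a b
  proof -
    have "0 \<le> c * \<sigma> (a, b)" "c * \<sigma> (a, b) = 0 \<longleftrightarrow> \<sigma> (a, b) = 0" using c P(1) by auto
    then show ?thesis using hc[of a b] unfolding \<rho>(2) fst_conv snd_conv by linarith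
  qed
  moreover have "\<sigma> (a, u) = 0 \<and> \<sigma> (b, v) = 0 \<or> \<sigma> (a, v) = 0 \<and> \<sigma> (b, u) = 0" if "\<rho> (a, b) = 1" for a b
  proof -
    have "\<bar>h a - h b\<bar> = 1" using that half[of "(a, b)"] unfolding \<rho>(2) fst_conv snd_conv by linarith
    then have "h a = 0 \<and> h b = 1 \<or> h a = 1 \<and> h b = 0" using h01[of a] h01[of b] by linarith
    then show ?thesis using h0 h1 by blast
  qed
  ultimately show thesis using one that by blast
qed

text \<open>This is the quotient pseudometric obtained by gluing \<open>x\<close> to
  \<open>y\<close>: one goes from \<open>a\<close> to \<open>b\<close> either directly or through
  the glued point, at cost \<open>f a + f b\<close>, where \<open>f\<close> is the distance to the
  set of \<open>x\<close> and \<open>y\<close>.\<close>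

lemma collapse:
  fixes x y :: 'a
  obtains \<sigma> where "\<sigma> \<in> PM"
    "\<And>a b. \<sigma> (a, b) = 0 \<longleftrightarrow> a = b \<or> a = x \<and> b = y \<or> a = y \<and> b = x"
proof -
  note P = PM_D[OF PM]
  define f where "f a = min (\<delta> (a, x)) (\<delta> (a, y))" for a
  have f: "0 \<le> f a" "f a = 0 \<longleftrightarrow> a = x \<or> a = y" for a
  proof -
    show "0 \<le> f a" using P(1) by (simp add: f_def)
    show "f a = 0 \<longleftrightarrow> a = x \<or> a = y"
      using P(1)[of a x] P(1)[of a y] eq_0_iff[of a x] eq_0_iff[of a y] unfolding f_def min_def by auto
  qed
  have lip: "f a \<le> \<delta> (a, b) + f b" for a b
    using P(4)[of a x b] P(4)[of a y b] unfolding f_def by linarith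
  let ?f = "\<lambda>p. min (\<delta> p) (f (fst p) + f (snd p))"
  obtain \<sigma> where \<sigma>: "\<sigma> \<in> PM" "\<And>p. apply_bcontfun \<sigma> p = ?f p"
  proof (rule PM_of_continuous[of ?f])
    show "continuous_on UNIV ?f"
      unfolding f_def by (intro continuous_intros continuous_on_slice continuous_on_apply_bcontfun)
    fix a b c
    show "0 \<le> ?f (a, b)" "?f (a, a) = 0" "?f (a, b) = ?f (b, a)"
      using P(1-3) f by (auto simp: add.commute)
    show "?f (a, c) \<le> ?f (a, b) + ?f (b, c)"
      using P(4)[of a c b] lip[of a b] lip[of c b] P(3)[of b c] f(1)[of b] unfolding fst_conv snd_conv by linarith
  qed blast
  have "\<sigma> (a, b) = 0 \<longleftrightarrow> \<delta> (a, b) = 0 \<or> f a = 0 \<and> f b = 0" for a b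
    using f(1)[of a] f(1)[of b] P(1)[of a b] unfolding \<sigma>(2) fst_conv snd_conv by linarith
  then show thesis using that[OF \<sigma>(1)] f(2) eq_0_iff by auto
qed

end

section \<open>Far sets, vanishing sets and faces of the sphere\<close>

definition vanishing :: "'a::topological_space \<times> 'a \<Rightarrow> (('a \<times> 'a) \<Rightarrow>\<^sub>C real) set" where
  "vanishing p = {\<rho> \<in> SPM. \<rho> p = 0}"

definition peaking :: "'a::topological_space \<times> 'a \<Rightarrow> (('a \<times> 'a) \<Rightarrow>\<^sub>C real) set" where
  "peaking p = {\<rho> \<in> SPM. \<rho> p = 1}"

text \<open>Distances on the sphere never exceed 1, so these are the points at the largest possible
  distance from \<open>d\<close>.\<close>

definition far :: "(('a::topological_space \<times> 'a) \<Rightarrow>\<^sub>C real) \<Rightarrow> (('a \<times> 'a) \<Rightarrow>\<^sub>C real) set" where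
  "far d = {\<rho> \<in> SPM. dist d \<rho> = 1}"

text \<open>Only distances on the sphere enter here, so the notion is invariant under surjective
  isometries.\<close>

definition minimal_far :: "(('a::topological_space \<times> 'a) \<Rightarrow>\<^sub>C real) set \<Rightarrow> bool" where
  "minimal_far A \<longleftrightarrow> (\<exists>d\<in>SPM. A = far d) \<and> (\<forall>d\<in>SPM. far d \<subseteq> A \<longrightarrow> far d = A)"

lemma vanishing_subset_far:
  assumes "d \<in> peaking p"
  shows "vanishing p \<subseteq> far d"
proof
  fix \<rho> assume \<rho>: "\<rho> \<in> vanishing p"
  have "dist (d p) (\<rho> p) = 1" using assms \<rho> by (simp add: vanishing_def peaking_def)
  then have "1 \<le> dist d \<rho>" using dist_bounded[of d p \<rho>] by simp
  then show "\<rho> \<in> far d"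
    using SPM_dist_le_1[of d \<rho>] assms \<rho> by (auto simp: vanishing_def peaking_def far_def)
qed

text \<open>The lower half of the formula \<open>1 - d p\<close> for the distance from
  \<open>d\<close> to a face; \<open>dist_peaking_attained\<close> supplies the other half.\<close>

lemma dist_peaking_ge:
  fixes d \<rho> :: "('a::topological_space \<times> 'a) \<Rightarrow>\<^sub>C real"
  assumes "\<rho> \<in> peaking p"
  shows "1 - d p \<le> dist d \<rho>"
  using dist_bounded[of d p \<rho>] assms by (simp add: peaking_def dist_real_def)

context compact_metrized
begin

text \<open>The distance is attained at some pair, and two numbers in the unit interval differ by 1
  only if they are 0 and 1.\<close>

lemma dist_eq_1_cases:
  assumes d: "d \<in> SPM" and \<rho>: "\<rho> \<in> SPM" and 1: "dist d \<rho> = 1"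
  obtains a b :: 'a where "d (a, b) = 1" "\<rho> (a, b) = 0" | a b where "d (a, b) = 0" "\<rho> (a, b) = 1"
proof -
  obtain p where p: "dist d \<rho> = \<bar>d p - \<rho> p\<bar>" by (rule dist_attained)
  obtain a b where ab: "p = (a, b)" by (metis surj_pair)
  have "0 \<le> d (a, b)" "d (a, b) \<le> 1" "0 \<le> \<rho> (a, b)" "\<rho> (a, b) \<le> 1"
    using d \<rho> SPM_D PM_D(1) by blast+
  then have "d (a, b) = 1 \<and> \<rho> (a, b) = 0 \<or> d (a, b) = 0 \<and> \<rho> (a, b) = 1"
    using p 1 unfolding ab by linarith
  then show thesis using that by blast
qed

text \<open>Take for \<open>e\<close> a metric that equals 1 only at \<open>(x, y)\<close> and
  \<open>(y, x)\<close>. A zero of \<open>e\<close> lies on the diagonal, where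
  \<open>\<rho>\<close> cannot be 1, so distance 1 forces \<open>\<rho>\<close> to vanish at
  \<open>(x, y)\<close>.\<close>

lemma vanishing_eq_far:
  fixes x y :: 'a
  assumes "x \<noteq> y"
  obtains e where "e \<in> SPM" "far e = vanishing (x, y)"
proof -
  obtain e where e: "e \<in> SPM" "\<And>a b. e (a, b) = 0 \<longleftrightarrow> \<delta> (a, b) = 0" "e (x, y) = 1"
    "\<And>a b. e (a, b) = 1 \<Longrightarrow> \<delta> (a, x) = 0 \<and> \<delta> (b, y) = 0 \<or> \<delta> (a, y) = 0 \<and> \<delta> (b, x) = 0"
    using peak[OF PM, of x y] assms eq_0_iff by metis
  have "far e \<subseteq> vanishing (x, y)"
  proof
    fix \<rho> assume "\<rho> \<in> far e"
    then have \<rho>: "\<rho> \<in> SPM" "dist e \<rho> = 1" by (auto simp: far_def)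
    then have P: "\<rho> \<in> PM" using SPM_D by blast
    show "\<rho> \<in> vanishing (x, y)"
      using e(1) \<rho>
    proof (cases rule: dist_eq_1_cases)
      case (1 a b)
      then have "(a, b) = (x, y) \<or> (a, b) = (y, x)" using e(4) eq_0_iff by blast
      then show ?thesis using 1 \<rho>(1) PM_D(3)[OF P, of x y] by (auto simp: vanishing_def)
    next
      case (2 a b)
      then show ?thesis using e(2) eq_0_iff PM_D(2)[OF P] by (metis zero_neq_one)
    qed
  qed
  then show thesis using that e vanishing_subset_far[of e "(x, y)"] by (auto simp: peaking_def)
qed

text \<open>If the unordered pairs differ, gluing \<open>x\<close> to \<open>y\<close> keeps
  \<open>u\<close> and \<open>v\<close> apart, which yields a point of the sphere that is 0 at
  \<open>(x, y)\<close> and 1 at \<open>(u, v)\<close>.\<close>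

lemma vanishing_subset_imp_eq:
  fixes x y u v :: 'a
  assumes sub: "vanishing (x, y) \<subseteq> vanishing (u, v)" and "u \<noteq> v"
  shows "vanishing (x, y) = vanishing (u, v)"
proof (cases "(u, v) = (x, y) \<or> (u, v) = (y, x)")
  case True
  have "vanishing (x, y) = vanishing (y, x)"
    using PM_D(3) SPM_D(1) unfolding vanishing_def by metis
  then show ?thesis using True by auto
next
  case False
  obtain \<sigma> where \<sigma>: "\<sigma> \<in> PM" "\<And>a b. \<sigma> (a, b) = 0 \<longleftrightarrow> a = b \<or> a = x \<and> b = y \<or> a = y \<and> b = x"
    using collapse[of x y] by blast
  have "\<sigma> (u, v) \<noteq> 0" "\<sigma> (x, y) = 0" using False \<sigma>(2) \<open>u \<noteq> v\<close> by auto
  then obtain \<rho> where "\<rho> \<in> SPM" "\<rho> (x, y) = 0" "\<rho> (u, v) = 1" using peak[OF \<sigma>(1)] by metis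
  then have "\<rho> \<in> vanishing (x, y)" "\<rho> \<notin> vanishing (u, v)" by (auto simp: vanishing_def)
  then show ?thesis using sub by blast
qed

lemma far_contains_vanishing:
  assumes "d \<in> SPM"
  obtains x y :: 'a where "x \<noteq> y" "vanishing (x, y) \<subseteq> far d"
proof -
  obtain x y where xy: "d (x, y) = 1" "x \<noteq> y" by (rule SPM_attained[OF assms])
  then have "vanishing (x, y) \<subseteq> far d" using assms by (simp add: vanishing_subset_far peaking_def)
  then show thesis using that xy(2) by blast
qed

text \<open>Every far set contains the vanishing set of a pair of distinct points, these vanishing
  sets are themselves far sets, and none of them properly contains another.\<close>

lemma minimal_far_iff: "minimal_far A \<longleftrightarrow> (\<exists>x y :: 'a. x \<noteq> y \<and> A = vanishing (x, y))"
proof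
  assume A: "minimal_far A"
  then obtain d where d: "d \<in> SPM" "A = far d" by (auto simp: minimal_far_def)
  obtain x y where "x \<noteq> y" "vanishing (x, y) \<subseteq> far d" using far_contains_vanishing[OF d(1)] by blast
  then show "\<exists>x y. x \<noteq> y \<and> A = vanishing (x, y)"
    using A d vanishing_eq_far unfolding minimal_far_def by metis
next
  assume "\<exists>x y. x \<noteq> y \<and> A = vanishing (x, y)"
  then obtain x y where xy: "x \<noteq> y" "A = vanishing (x, y)" by blast
  show "minimal_far A"
    unfolding minimal_far_def
  proof (intro conjI ballI impI)
    show "\<exists>d\<in>SPM. A = far d" using vanishing_eq_far xy by metis
    fix d assume d: "d \<in> SPM" "far d \<subseteq> A"
    obtain u v where "u \<noteq> v" "vanishing (u, v) \<subseteq> far d" using far_contains_vanishing[OF d(1)] by blast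
    then show "far d = A" using vanishing_subset_imp_eq[of u v x y] d xy by blast
  qed
qed

text \<open>If \<open>d (x, y) < 1\<close>, then \<open>d\<close> attains the value 1 at some other pair \<open>(u, v)\<close>; a pseudometric that
  identifies only \<open>x\<close> with \<open>y\<close> and peaks only at the class of \<open>(u, v)\<close> vanishes at \<open>(x, y)\<close> but is not
  far from \<open>d\<close>.\<close>
lemma peaking_eq:
  fixes x y :: 'a
  assumes "x \<noteq> y"
  shows "peaking (x, y) = {d \<in> SPM. vanishing (x, y) \<subseteq> far d}"
proof (intro equalityI subsetI)
  fix d assume "d \<in> peaking (x, y)"
  then show "d \<in> {d \<in> SPM. vanishing (x, y) \<subseteq> far d}"
    using vanishing_subset_far by (auto simp: peaking_def)
next
  fix d assume "d \<in> {d \<in> SPM. vanishing (x, y) \<subseteq> far d}"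
  then have d: "d \<in> SPM" "vanishing (x, y) \<subseteq> far d" by auto
  note P = PM_D[OF SPM_D(1)[OF d(1)]]
  have "d (x, y) = 1"
  proof (rule ccontr)
    assume "d (x, y) \<noteq> 1"
    then have lt: "d (x, y) < 1" using SPM_D(3)[OF d(1), of "(x, y)"] by simp
    obtain u v where uv: "d (u, v) = 1" "u \<noteq> v" by (rule SPM_attained[OF d(1)])
    obtain \<sigma> where \<sigma>: "\<sigma> \<in> PM" "\<And>a b. \<sigma> (a, b) = 0 \<longleftrightarrow> a = b \<or> a = x \<and> b = y \<or> a = y \<and> b = x"
      using collapse[of x y] by blast
    have "\<sigma> (u, v) \<noteq> 0" using \<sigma>(2) uv lt P(3)[of x y] by auto
    then obtain \<rho> where \<rho>: "\<rho> \<in> SPM" "\<And>a b. \<rho> (a, b) = 0 \<longleftrightarrow> \<sigma> (a, b) = 0"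
      "\<And>a b. \<rho> (a, b) = 1 \<Longrightarrow> \<sigma> (a, u) = 0 \<and> \<sigma> (b, v) = 0 \<or> \<sigma> (a, v) = 0 \<and> \<sigma> (b, u) = 0"
      using peak[OF \<sigma>(1)] by metis
    have d\<sigma>: "d (a, b) \<le> d (x, y)" "d (a, b) < 1" if "\<sigma> (a, b) = 0" for a b
      using that \<sigma>(2)[of a b] lt P(1)[of x y] P(2)[of a] P(3)[of x y] by auto
    have "\<rho> (x, y) = 0" using \<rho>(2) \<sigma>(2) by blast
    then have "dist d \<rho> = 1" using d(2) \<rho>(1) by (auto simp: vanishing_def far_def)
    with d(1) \<rho>(1) show False
    proof (cases rule: dist_eq_1_cases)
      case (1 a b)
      then show False using \<rho>(2) d\<sigma>(2) by force
    next
      case (2 a b)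
      \<comment> \<open>If \<open>a\<close> differs from \<open>u\<close> and \<open>b\<close> from
        \<open>v\<close>, then \<open>u\<close> and \<open>v\<close> are the glued points,
        contradicting \<open>d (x, y) < 1\<close>. Otherwise one leg of the triangle inequality for
        \<open>d (u, v)\<close> is 0 and the other is below 1.\<close>
      have *: False if ab: "\<sigma> (a, u) = 0" "\<sigma> (b, v) = 0" "d (a, b) = 0" for a b
      proof -
        have "a = u \<or> b = v"
          using ab \<sigma>(2)[of a u] \<sigma>(2)[of b v] uv lt P(3)[of x y] assms by auto
        then show False
          using ab uv(1) d\<sigma>(2)[of a u] d\<sigma>(2)[of b v] P(3)[of a u] P(4)[of u v a] P(4)[of u v b] by auto
      qed
      show False using \<rho>(3)[OF 2(2)] 2(1) *[of a b] *[of b a] P(3)[of a b] by auto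
    qed
  qed
  then show "d \<in> peaking (x, y)" using d by (simp add: peaking_def)
qed

text \<open>Truncating \<open>d (x, \<cdot>)\<close> at \<open>d (x, y)\<close> and adding a multiple of a function
  that separates \<open>x\<close> from \<open>y\<close> gives a function whose increments are bounded by
  \<open>d + (1 - d (x, y))\<close>.\<close>
lemma dist_peaking_attained:
  fixes x y :: 'a
  assumes d: "d \<in> SPM" and "x \<noteq> y"
  obtains \<rho> where "\<rho> \<in> peaking (x, y)" "dist d \<rho> \<le> 1 - d (x, y)"
proof -
  note P = PM_D[OF SPM_D(1)[OF d]]
  note Q = PM_D[OF PM]
  define t where "t = 1 - d (x, y)"
  have t: "0 \<le> t" using SPM_D(3)[OF d] by (simp add: t_def)
  have xy: "0 < \<delta> (x, y)" using Q(1)[of x y] eq_0_iff[of x y] \<open>x \<noteq> y\<close> by simp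
  define g where "g a = min 1 (\<delta> (a, x) / \<delta> (x, y))" for a
  have g: "0 \<le> g a" "g a \<le> 1" for a using xy Q(1) by (auto simp: g_def)
  define h where "h a = min (d (a, x)) (d (x, y)) + t * g a" for a
  have hx: "h x = 0" and hy: "h y = 1"
    using xy P Q P(3)[of y x] Q(3)[of y x] by (auto simp: h_def g_def t_def)
  have h01: "0 \<le> h a" "h a \<le> 1" for a
    using P(1) t g[of a] mult_left_le[OF g(2) t, of a] by (auto simp: h_def t_def)
  have inc: "h a - h b \<le> d (a, b) + t" for a b
  proof -
    have "t * g a \<le> t" "0 \<le> t * g b" using t g by (auto intro: mult_left_le)
    then show ?thesis using P(4)[of a x b] P(1)[of a b] unfolding h_def by linarith
  qed
  \<comment> \<open>The maximum with \<open>d\<close> gives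
    \<open>d \<le> \<rho> \<le> d + t\<close> pointwise, since \<open>inc\<close> bounds the
    increments of \<open>h\<close> in both directions.\<close>
  let ?f = "\<lambda>p. max (d p) \<bar>h (fst p) - h (snd p)\<bar>"
  obtain \<rho> where \<rho>: "\<rho> \<in> PM" "\<And>p. apply_bcontfun \<rho> p = ?f p"
  proof (rule PM_of_continuous[of ?f])
    show "continuous_on UNIV ?f"
      unfolding h_def g_def using xy
      by (intro continuous_intros continuous_on_slice continuous_on_apply_bcontfun) auto
    fix a b c
    show "0 \<le> ?f (a, b)" "?f (a, a) = 0" "?f (a, b) = ?f (b, a)"
      using P(1-3) by (auto simp: abs_minus_commute)
    show "?f (a, c) \<le> ?f (a, b) + ?f (b, c)"
      using P(4)[of a c b] by auto
  qed blast
  have one: "\<rho> (x, y) = 1" using SPM_D(3)[OF d, of "(x, y)"] by (simp add: \<rho>(2) hx hy)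
  have le1: "\<rho> p \<le> 1" for p
    using SPM_D(3)[OF d, of p] h01[of "fst p"] h01[of "snd p"] unfolding \<rho>(2) by (auto simp: abs_le_iff)
  have "norm \<rho> = 1"
  proof (rule antisym)
    show "norm \<rho> \<le> 1"
      using le1 PM_D(1)[OF \<rho>(1)] by (intro norm_bound) (metis abs_of_nonneg real_norm_def surj_pair)
    show "1 \<le> norm \<rho>" using norm_bounded[of \<rho> "(x, y)"] one by simp
  qed
  then have "\<rho> \<in> peaking (x, y)" using \<rho>(1) one by (simp add: SPM_def peaking_def)
  moreover have "dist d \<rho> \<le> t"
  proof (rule dist_bound)
    fix p :: "'a \<times> 'a"
    obtain a b where p: "p = (a, b)" by (metis surj_pair)
    show "dist (d p) (\<rho> p) \<le> t"
      using inc[of a b] inc[of b a] P(3)[of a b] t unfolding \<rho>(2) p dist_real_def fst_conv snd_conv by linarith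
  qed
  ultimately show thesis using that by (simp add: t_def)
qed

section \<open>Density of admissible metrics in the sphere and existence of a metrizing
  element\<close>

text \<open>Adding a small positive multiple of \<open>\<delta>\<close> to \<open>d\<close> and
  normalising gives a metric that dominates a positive multiple of \<open>\<delta>\<close>, hence an
  admissible one by \<open>AM_ge\<close>.\<close>

lemma closure_SPM_AM: "closure (SPM \<inter> AM) = (SPM :: (('a \<times> 'a) \<Rightarrow>\<^sub>C real) set)"
proof
  show "closure (SPM \<inter> AM) \<subseteq> (SPM :: (('a \<times> 'a) \<Rightarrow>\<^sub>C real) set)"
    by (rule closure_minimal) (simp_all add: closed_SPM)
  show "(SPM :: (('a \<times> 'a) \<Rightarrow>\<^sub>C real) set) \<subseteq> closure (SPM \<inter> AM)"
  proof
    fix d :: "('a \<times> 'a) \<Rightarrow>\<^sub>C real" assume d: "d \<in> SPM"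
    define f where "f n = d + (inverse (real (Suc n))) *\<^sub>R \<delta>" for n
    have f: "f \<longlonglongrightarrow> d"
      unfolding f_def
      using tendsto_add[OF tendsto_const tendsto_scaleR[OF LIMSEQ_inverse_real_of_nat tendsto_const], of d \<delta>]
      by (simp only: scaleR_zero_left add_0_right)
    have nf: "(\<lambda>n. norm (f n)) \<longlonglongrightarrow> 1" using tendsto_norm[OF f] SPM_D(2)[OF d] by simp
    have lim: "(\<lambda>n. (1 / norm (f n)) *\<^sub>R f n) \<longlonglongrightarrow> d"
      using tendsto_scaleR[OF tendsto_divide[OF tendsto_const nf] f, of 1] by simp
    have "(1 / norm (f n)) *\<^sub>R f n \<in> SPM \<inter> AM" for n
    proof -
      have PMf: "f n \<in> PM" using PM_comb[OF SPM_D(1)[OF d] PM, of 1 "inverse (real (Suc n))"] by (simp add: f_def)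
      have ge: "(inverse (real (Suc n))) * \<delta> p \<le> f n p" for p
        using PM_D(1)[OF SPM_D(1)[OF d]] by (cases p) (simp add: f_def)
      \<comment> \<open>Non-degeneracy enters here: \<open>\<delta>\<close> is positive at some
        pair, so \<open>f n\<close> can be normalised.\<close>
      have "f n \<noteq> 0"
      proof
        assume 0: "f n = 0"
        obtain x y :: 'a where "x \<noteq> y" using nondegenerate by blast
        then have "0 < \<delta> (x, y)" using eq_0_iff[of x y] PM_D(1)[OF PM, of x y] by linarith
        then have "0 < (inverse (real (Suc n))) * \<delta> (x, y)" by simp
        then show False using ge[of "(x, y)"] 0 by simp
      qed
      then have S: "(1 / norm (f n)) *\<^sub>R f n \<in> SPM" and N: "0 < norm (f n)"
        using SPM_normalize[OF PMf] by auto
      have "(1 / norm (f n)) *\<^sub>R f n \<in> AM"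
      proof (rule AM_ge[OF AM SPM_D(1)[OF S]])
        show "0 < 1 / norm (f n) * (inverse (real (Suc n)))" using N by simp
        show "1 / norm (f n) * (inverse (real (Suc n))) * \<delta> p \<le> ((1 / norm (f n)) *\<^sub>R f n) p" for p
          using mult_left_mono[OF ge[of p], of "1 / norm (f n)"] N by (simp add: mult.assoc)
      qed
      then show ?thesis using S by blast
    qed
    then show "d \<in> closure (SPM \<inter> AM)"
      unfolding closure_sequential using lim by (intro exI[of _ "\<lambda>n. (1 / norm (f n)) *\<^sub>R f n"]) blast
  qed
qed

end

lemma compact_metrized_exists:
  assumes "compact (UNIV :: 'a::topological_space set)" "metrizable_space (euclidean :: 'a topology)"
    "\<exists>x y :: 'a. x \<noteq> y"
  shows "\<exists>\<delta> :: ('a \<times> 'a) \<Rightarrow>\<^sub>C real. compact_metrized \<delta>"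
proof -
  obtain M m where "Metric_space M m" and eu: "euclidean = Metric_space.mtopology M (m :: 'a \<Rightarrow> 'a \<Rightarrow> real)"
    using assms(2) unfolding metrizable_space_def by blast
  then interpret M0: Metric_space M m by simp
  \<comment> \<open>The carrier of a metric inducing the topology is the whole topological space,
    here the full type.\<close>
  have M: "M = UNIV" using M0.topspace_mtopology eu by (metis topspace_euclidean)
  interpret Metric_space UNIV m using M0.Metric_space_axioms M by simp
  have eu: "mtopology = euclidean" using eu M by simp
  let ?f = "\<lambda>p. m (fst p) (snd p)"
  have "continuous_map (prod_topology euclidean euclidean) euclidean (\<lambda>(x, y). m x y)"
    using continuous_map_metric[of Self] by (simp add: mtopology_of_def eu)
  then have cont: "continuous_on UNIV ?f" by (simp add: case_prod_unfold)
  have "compact (UNIV :: ('a \<times> 'a) set)" using compact_Times[OF assms(1,1)] by simp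
  then have "?f \<in> bcontfun"
    using cont compact_continuous_image[OF cont] by (simp add: bcontfun_def compact_imp_bounded)
  then have f: "apply_bcontfun (Bcontfun ?f) = ?f" by (rule Bcontfun_inverse)
  have "Bcontfun ?f \<in> AM"
    unfolding AM_def PM_def using eu Metric_space_axioms by (auto simp: f commute triangle)
  then show ?thesis using assms by (auto intro: compact_metrized.intro)
qed

section \<open>The action of isometries of the sphere on pairs of points\<close>

lemma far_image:
  assumes T: "surjective_isometry SPM SPM T" and d: "d \<in> SPM"
  shows "far (T d) = T ` far d"
proof (intro equalityI subsetI)
  note TD = surjective_isometryD[OF T]
  fix e assume "e \<in> far (T d)"
  then have e: "e \<in> SPM" "dist (T d) e = 1" by (auto simp: far_def)
  then obtain \<rho> where \<rho>: "\<rho> \<in> SPM" "T \<rho> = e" using TD(2) by blast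
  then have "\<rho> \<in> far d" using e(2) TD(3)[OF d \<rho>(1)] by (simp add: far_def)
  then show "e \<in> T ` far d" using \<rho>(2) by blast
next
  note TD = surjective_isometryD[OF T]
  fix e assume "e \<in> T ` far d"
  then show "e \<in> far (T d)" using TD(1) TD(3)[OF d] by (auto simp: far_def)
qed

lemma minimal_far_image:
  assumes T: "surjective_isometry SPM SPM T" and A: "minimal_far A"
  shows "minimal_far (T ` A)"
  unfolding minimal_far_def
proof (intro conjI ballI impI)
  note TD = surjective_isometryD[OF T]
  show "\<exists>d\<in>SPM. T ` A = far d"
    using A TD(1) far_image[OF T] unfolding minimal_far_def by metis
  fix e assume "e \<in> SPM" and sub: "far e \<subseteq> T ` A"
  then obtain d where d: "d \<in> SPM" "T d = e" using TD(2) by blast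
  have "A \<subseteq> SPM" using A unfolding minimal_far_def far_def by blast
  then have "far d \<subseteq> A"
    using sub far_image[OF T d(1)] d(2) surjective_isometry_inv_into(1)[OF T]
    by (metis (no_types, lifting) far_def inj_on_image_subset_iff mem_Collect_eq subsetI)
  then show "far e = T ` A" using A d far_image[OF T d(1)] unfolding minimal_far_def by metis
qed

text \<open>Minimal far sets determine the pair \<open>(u, v)\<close>. The face at
  \<open>(x, y)\<close> then goes to the face at \<open>(u, v)\<close>, and comparing the distances
  to these faces compares the values.\<close>

lemma surjective_isometry_pair:
  fixes T :: "(('a::topological_space \<times> 'a) \<Rightarrow>\<^sub>C real) \<Rightarrow> (('b::topological_space \<times> 'b) \<Rightarrow>\<^sub>C real)"
  assumes X: "compact_metrized (\<delta> :: ('a \<times> 'a) \<Rightarrow>\<^sub>C real)"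
    and Y: "compact_metrized (\<epsilon> :: ('b \<times> 'b) \<Rightarrow>\<^sub>C real)"
    and T: "surjective_isometry SPM SPM T" and "x \<noteq> y"
  obtains u v where "\<And>d. d \<in> SPM \<Longrightarrow> T d (u, v) = d (x, y)"
proof -
  note TD = surjective_isometryD[OF T]
  note inj = surjective_isometry_inv_into(1)[OF T]
  have "minimal_far (vanishing (x, y))"
    using compact_metrized.minimal_far_iff[OF X, THEN iffD2] \<open>x \<noteq> y\<close> by blast
  then obtain u v where uv: "u \<noteq> v" "T ` vanishing (x, y) = vanishing (u, v)"
    using compact_metrized.minimal_far_iff[OF Y, THEN iffD1, OF minimal_far_image[OF T]] by blast
  \<comment> \<open>By \<open>peaking_eq\<close>, membership in a face is an inclusion between a
    vanishing set and a far set, and \<open>T\<close> transports both.\<close>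
  have peak: "T d \<in> peaking (u, v) \<longleftrightarrow> d \<in> peaking (x, y)" if d: "d \<in> SPM" for d
  proof -
    have "vanishing (u, v) \<subseteq> far (T d) \<longleftrightarrow> vanishing (x, y) \<subseteq> far d"
      unfolding uv(2)[symmetric] far_image[OF T d]
      by (rule inj_on_image_subset_iff[OF inj]) (auto simp: vanishing_def far_def)
    then show ?thesis
      unfolding compact_metrized.peaking_eq[OF X \<open>x \<noteq> y\<close>] compact_metrized.peaking_eq[OF Y uv(1)]
      using d TD(1)[OF d] by simp
  qed
  have "T d (u, v) = d (x, y)" if d: "d \<in> SPM" for d
  proof (rule antisym)
    obtain \<rho> where \<rho>: "\<rho> \<in> peaking (u, v)" "dist (T d) \<rho> \<le> 1 - T d (u, v)"
      using compact_metrized.dist_peaking_attained[OF Y TD(1)[OF d] uv(1)] by blast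
    then obtain \<rho>' where \<rho>': "\<rho>' \<in> SPM" "T \<rho>' = \<rho>" using TD(2) by (auto simp: peaking_def)
    then have "1 - d (x, y) \<le> dist d \<rho>'"
      using dist_peaking_ge peak[OF \<rho>'(1)] \<rho>(1) by blast
    also have "\<dots> = dist (T d) \<rho>" using TD(3) \<rho>' d by metis
    finally show "T d (u, v) \<le> d (x, y)" using \<rho>(2) by simp
    obtain \<rho> where \<rho>: "\<rho> \<in> peaking (x, y)" "dist d \<rho> \<le> 1 - d (x, y)"
      using compact_metrized.dist_peaking_attained[OF X d \<open>x \<noteq> y\<close>] by blast
    then have \<rho>S: "\<rho> \<in> SPM" by (simp add: peaking_def)
    have "1 - T d (u, v) \<le> dist (T d) (T \<rho>)"
      using dist_peaking_ge peak[OF \<rho>S] \<rho>(1) by blast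
    also have "\<dots> = dist d \<rho>" using TD(3) d \<rho>S by blast
    finally show "d (x, y) \<le> T d (u, v)" using \<rho>(2) by simp
  qed
  then show thesis using that by blast
qed

text \<open>\<open>T d\<close> and \<open>d\<close> are the same function up to a correspondence between the pairs of points of the
  two spaces; the homogeneous extension inherits this correspondence, which makes linearity and isometry
  pointwise facts.\<close>
lemma SPM_isometry_extends:
  fixes T :: "(('a::topological_space \<times> 'a) \<Rightarrow>\<^sub>C real) \<Rightarrow> (('b::topological_space \<times> 'b) \<Rightarrow>\<^sub>C real)"
  assumes X: "compact_metrized (\<delta> :: ('a \<times> 'a) \<Rightarrow>\<^sub>C real)"
    and Y: "compact_metrized (\<epsilon> :: ('b \<times> 'b) \<Rightarrow>\<^sub>C real)"
    and T: "surjective_isometry SPM SPM T"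
  obtains U where "U \<in> PM \<rightarrow>\<^sub>E PM" "\<And>d. d \<in> SPM \<Longrightarrow> U d = T d"
    "real_linear U" "surjective_isometry PM PM U"
proof -
  note TD = surjective_isometryD[OF T]
  note inv = surjective_isometry_inv_into[OF T]
  \<comment> \<open>At \<open>d = 0\<close> the factor \<open>norm d\<close> is 0, so the value of
    \<open>T\<close> there has no effect. The restriction fixes the values outside the cone.\<close>
  define U where "U = restrict (\<lambda>d. norm d *\<^sub>R T ((1 / norm d) *\<^sub>R d)) PM"
  have U: "U d = norm d *\<^sub>R T ((1 / norm d) *\<^sub>R d)" if "d \<in> PM" for d using that by (simp add: U_def)
  have UPM: "U d \<in> PM" if "d \<in> PM" for d
  proof (cases "d = 0")
    case True
    then show ?thesis using U[OF that] PM_zero by simp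
  next
    case False
    then show ?thesis using U[OF that] SPM_D(1)[OF TD(1)[OF SPM_normalize[OF that]]] PM_scale by force
  qed
  have transfer: "U d q = d p" if d: "d \<in> PM" and pq: "\<And>d. d \<in> SPM \<Longrightarrow> T d q = d p" for d p q
  proof (cases "d = 0")
    case False
    then show ?thesis using U[OF d] pq[OF SPM_normalize[OF d False]] by simp
  qed (use U[OF d] in simp)
  have fwd: "\<exists>q. \<forall>d\<in>PM. U d q = d p" for p
  proof (cases p)
    case (Pair x y)
    show ?thesis
    proof (cases "x = y")
      case True
      \<comment> \<open>A diagonal pair corresponds to any diagonal pair, since pseudometrics vanish
        on both.\<close>
      have "\<forall>d\<in>PM. U d (z, z) = d p" for z using PM_D(2) UPM Pair True by metis
      then show ?thesis by blast
    next
      case False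
      then show ?thesis using surjective_isometry_pair[OF X Y T False] transfer Pair by metis
    qed
  qed
  have bwd: "\<exists>p. \<forall>d\<in>PM. U d q = d p" for q
  proof (cases q)
    case (Pair x y)
    show ?thesis
    proof (cases "x = y")
      case True
      have "\<forall>d\<in>PM. U d q = d (z, z)" for z using PM_D(2) UPM Pair True by metis
      then show ?thesis by blast
    next
      case False
      \<comment> \<open>Applied to the inverse isometry, the previous lemma assigns a pair in the
        source to each pair of distinct points in the target.\<close>
      obtain u v where uv: "\<And>e. e \<in> SPM \<Longrightarrow> inv_into SPM T e (u, v) = e (x, y)"
        using surjective_isometry_pair[OF Y X inv(2) False] by blast
      have "T d q = d (u, v)" if "d \<in> SPM" for d
        using uv[OF TD(1)[OF that]] inv_into_f_f[OF inv(1) that] Pair by simp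
      then show ?thesis using transfer by blast
    qed
  qed
  have "U \<in> PM \<rightarrow>\<^sub>E PM" using UPM unfolding U_def by (auto simp: PiE_def extensional_def)
  moreover have "U d = T d" if "d \<in> SPM" for d
    using U[OF SPM_D(1)[OF that]] SPM_D(2)[OF that] by simp
  moreover have "real_linear U"
    unfolding real_linear_def
  proof (intro ballI allI impI bcontfun_eqI)
    fix d \<rho> :: "('a \<times> 'a) \<Rightarrow>\<^sub>C real" and \<alpha> \<beta> :: real and q
    assume *: "d \<in> PM" "\<rho> \<in> PM" "0 \<le> \<alpha>" "0 \<le> \<beta>"
    obtain p where "\<forall>d\<in>PM. U d q = d p" using bwd by blast
    then show "U (\<alpha> *\<^sub>R d + \<beta> *\<^sub>R \<rho>) q = (\<alpha> *\<^sub>R U d + \<beta> *\<^sub>R U \<rho>) q"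
      using * PM_comb[OF *] by simp
  qed
  moreover have "surjective_isometry PM PM U"
    unfolding surjective_isometry_def
  proof (intro conjI ballI)
    show "U ` PM = PM"
    proof (intro equalityI subsetI)
      fix e :: "('b \<times> 'b) \<Rightarrow>\<^sub>C real" assume e: "e \<in> PM"
      show "e \<in> U ` PM"
      proof (cases "e = 0")
        case True
        then show ?thesis using U[OF PM_zero] PM_zero by (metis image_eqI norm_zero scaleR_zero_left)
      next
        case False
        obtain d where d: "d \<in> SPM" "T d = (1 / norm e) *\<^sub>R e"
          using TD(2)[OF SPM_normalize[OF e False]] by blast
        have PMd: "norm e *\<^sub>R d \<in> PM" by (rule PM_scale[OF SPM_D(1)[OF d(1)] norm_ge_zero])
        have "U (norm e *\<^sub>R d) = e" using U[OF PMd] SPM_D(2)[OF d(1)] d(2) False by simp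
        then show ?thesis using imageI[OF PMd, of U] by simp
      qed
    qed (use UPM in blast)
    fix d \<rho> :: "('a \<times> 'a) \<Rightarrow>\<^sub>C real" assume *: "d \<in> PM" "\<rho> \<in> PM"
    show "dist (U d) (U \<rho>) = dist d \<rho>"
    \<comment> \<open>Each value difference on one side occurs on the other: \<open>bwd\<close>
      gives one inequality of suprema and \<open>fwd\<close> the reverse one.\<close>
    proof (rule antisym; rule dist_bound)
      show "dist (U d q) (U \<rho> q) \<le> dist d \<rho>" for q using bwd[of q] * dist_bounded by metis
      show "dist (d p) (\<rho> p) \<le> dist (U d) (U \<rho>)" for p using fwd[of p] * dist_bounded by metis
    qed
  qed
  ultimately show thesis using that by blast
qed

section \<open>Uniqueness of the extension and reduction of both cases to the full sphere\<close>

lemma surjective_isometry_continuous_on: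
  assumes "surjective_isometry A B T"
  shows "continuous_on A T"
  using surjective_isometryD(3)[OF assms] unfolding continuous_on_iff by metis

text \<open>Every non-zero pseudometric is a positive multiple of a point of the sphere, and
  homogeneity fixes the value at 0.\<close>

lemma real_linear_eqI:
  fixes U V :: "(('a::topological_space \<times> 'a) \<Rightarrow>\<^sub>C real) \<Rightarrow> (('b::topological_space \<times> 'b) \<Rightarrow>\<^sub>C real)"
  assumes "real_linear U" "real_linear V" and eq: "\<And>d. d \<in> SPM \<Longrightarrow> U d = V d" and d: "d \<in> PM"
  shows "U d = V d"
proof -
  have hom: "W (\<alpha> *\<^sub>R d) = \<alpha> *\<^sub>R W d" if "real_linear W" "d \<in> PM" "0 \<le> \<alpha>"
    for \<alpha> d and W :: "(('a \<times> 'a) \<Rightarrow>\<^sub>C real) \<Rightarrow> (('b \<times> 'b) \<Rightarrow>\<^sub>C real)"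
    using that(1)[unfolded real_linear_def, rule_format, OF that(2,2,3), of 0] by simp
  show ?thesis
  proof (cases "d = 0")
    case True
    then show ?thesis using hom[OF assms(1) d, of 0] hom[OF assms(2) d, of 0] by simp
  next
    case False
    note S = SPM_normalize[OF d False]
    have "d = norm d *\<^sub>R ((1 / norm d) *\<^sub>R d)" using False by simp
    then show ?thesis using hom[OF assms(1) SPM_D(1)[OF S]] hom[OF assms(2) SPM_D(1)[OF S]] eq[OF S]
      by (metis norm_ge_zero)
  qed
qed

theorem corollary1p2:
  fixes T :: "(('a::topological_space \<times> 'a) \<Rightarrow>\<^sub>C real) \<Rightarrow> (('b::topological_space \<times> 'b) \<Rightarrow>\<^sub>C real)"
    and D :: "(('a \<times> 'a) \<Rightarrow>\<^sub>C real) set"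
    and E :: "(('b \<times> 'b) \<Rightarrow>\<^sub>C real) set"
  assumes "compact (UNIV :: 'a set)" and "metrizable_space (euclidean :: 'a topology)"
    and "\<exists>x y :: 'a. x \<noteq> y"
    and "compact (UNIV :: 'b set)" and "metrizable_space (euclidean :: 'b topology)"
    and "\<exists>x y :: 'b. x \<noteq> y"
    and "(D = SPM \<and> E = SPM) \<or> (D = SPM \<inter> AM \<and> E = SPM \<inter> AM)"
    and "surjective_isometry D E T"
  shows "\<exists>!Tbar. Tbar \<in> PM \<rightarrow>\<^sub>E PM \<and> (\<forall>d\<in>D. Tbar d = T d) \<and>
           real_linear Tbar \<and> surjective_isometry PM PM Tbar"
proof -
  obtain \<delta> :: "('a \<times> 'a) \<Rightarrow>\<^sub>C real" where X: "compact_metrized \<delta>"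
    using compact_metrized_exists[OF assms(1-3)] by blast
  obtain \<epsilon> :: "('b \<times> 'b) \<Rightarrow>\<^sub>C real" where Y: "compact_metrized \<epsilon>"
    using compact_metrized_exists[OF assms(4-6)] by blast
  \<comment> \<open>Both cases merge here: the sphere is closed and its admissible metrics are dense
    in it.\<close>
  have D: "D \<subseteq> SPM" and cl: "closure D = SPM" "closure E = SPM"
    using assms(7) compact_metrized.closure_SPM_AM[OF X] compact_metrized.closure_SPM_AM[OF Y]
    by (auto simp: closure_closed[OF closed_SPM])
  obtain T' where T': "surjective_isometry SPM SPM T'" "\<And>d. d \<in> D \<Longrightarrow> T' d = T d"
    using surjective_isometry_closure[OF assms(8) bcontfun_complete bcontfun_complete] cl by metis
  obtain U where U: "U \<in> PM \<rightarrow>\<^sub>E PM" "\<And>d. d \<in> SPM \<Longrightarrow> U d = T' d"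
    "real_linear U" "surjective_isometry PM PM U"
    using SPM_isometry_extends[OF X Y T'(1)] by blast
  show ?thesis
  proof (rule ex1I[of _ U])
    show "U \<in> PM \<rightarrow>\<^sub>E PM \<and> (\<forall>d\<in>D. U d = T d) \<and> real_linear U \<and> surjective_isometry PM PM U"
      using U T'(2) D by auto
    fix V assume V: "V \<in> PM \<rightarrow>\<^sub>E PM \<and> (\<forall>d\<in>D. V d = T d) \<and> real_linear V \<and> surjective_isometry PM PM V"
    have sub: "closure D \<subseteq> PM" using SPM_D(1) cl by blast
    \<comment> \<open>\<open>V\<close> and \<open>T'\<close> are continuous on the sphere and agree
      on its dense subset \<open>D\<close>.\<close>
    have "V d = T' d" if "d \<in> SPM" for d
    proof -
      have "continuous_on (closure D) V" "continuous_on (closure D) T'"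
        using surjective_isometry_continuous_on V T'(1) sub cl continuous_on_subset by metis+
      then have "continuous_on (closure D) (\<lambda>d. V d - T' d)" by (rule continuous_on_diff)
      then have "V d - T' d = 0"
        by (rule continuous_constant_on_closure) (use V T'(2) cl that in auto)
      then show ?thesis by simp
    qed
    then have "V d = U d" if "d \<in> PM" for d
      using real_linear_eqI[of V U d] U V that by metis
    \<comment> \<open>Both maps take the same default value outside \<open>PM\<close>, so agreement
      on \<open>PM\<close> is equality.\<close>
    then show "V = U" using U(1) V by (meson PiE_ext)
  qed
qed

end
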